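(* Let $G$ be a graph, $v$ a vertex of $G$, and $\rho:U_vG\to G$ the universal homotopy cover. Suppose $f:\widetilde G\to G$ is a homotopy covering map and $\tilde v\in f^{-1}(v)$. Then there is a unique graph morphism $\tilde\rho:U_vG\to\widetilde G$ such that $\rho=f\circ\tilde\rho$ and $\tilde\rho([v])=\tilde v$, and this $\tilde\rho$ is a homotopy covering map.
   Context: All graphs are undirected, have no multiple edges, may have loops, are connected, and are not a single isolated vertex. Adjacency is written $x\sim y$; a graph morphism preserves adjacency. A walk of length $n$ is a sequence $(v_0\cdots v_n)$ with $v_i\sim v_{i+1}$; $N_2(v)$ is the set of walks of length 2 starting at $v$. A homotopy covering map is a morphism $f:\widetilde G\to G$ such that for every vertex $\tilde v$, applying $f$ vertexwise gives a bijection $N_2(\tilde v)\to N_2(f(\tilde v))$ which respects endpoints (two walks in $N_2(\tilde v)$ end at the same vertex iff their images do). A prune of a walk with $v_i=v_{i+2}$ replaces the segment $v_iv_{i+1}v_i$ by $v_i$. A spider move on a walk $(v_0\cdots v_n)$ replaces one vertex $v_i$, $0<i<n$, by $v_i'$ with $v_{i-1}\sim v_i'\sim v_{i+1}$. Walks are equivalent if connected by finitely many prunes, inverse prunes and spider moves. The fundamental groupoid $\Pi(G)$ has objects the vertices and arrows $v\to w$ the equivalence classes of walks from $v$ to $w$, composed by concatenation ($\alpha*\beta$ = $\alpha$ followed by $\beta$); $\Pi_v(G)$ is the set of arrows with source $v$. The universal homotopy cover $U_vG$ is the graph whose vertices are the arrows in $\Pi_v(G)$, with $\alpha\sim\beta$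 iff $\beta=\alpha*[(wx)]$ for some edge $w\sim x$ of $G$ with $w$ the target of $\alpha$; $\rho:U_vG\to G$ sends an arrow to its target, and $[v]$ denotes the class of the length-0 walk $(v)$. *)

theory Defs
  imports "Graph_Theory.Digraph_Component" "Graph_Theory.Vertex_Walk"
begin

text \<open>
  Undirected graphs without multiple edges, possibly with loops and possibly infinite, are
  symmetric sets of pairs; \<open>pair_sym_digraph\<close> assumes neither finiteness nor loop-freeness.
\<close>

locale htpy_graph = pair_sym_digraph G for G :: "'a pair_pre_digraph" +
  assumes connected: "Digraph_Component.connected (with_proj G)"
    and not_isolated_vertex: "\<not> (\<exists>v. pverts G = {v} \<and> parcs G = {})"

definition graph_morphism ::
  "'a pair_pre_digraph \<Rightarrow> 'b pair_pre_digraph \<Rightarrow> ('a \<Rightarrow> 'b) \<Rightarrow> bool" where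
  "graph_morphism G H f \<longleftrightarrow>
     (\<forall>x\<in>pverts G. f x \<in> pverts H) \<and> (\<forall>x y. (x, y) \<in> parcs G \<longrightarrow> (f x, f y) \<in> parcs H)"

definition walks :: "'a pair_pre_digraph \<Rightarrow> 'a vwalk set" where
  "walks G = {p. vwalk p (with_proj G)}"

definition N2 :: "'a pair_pre_digraph \<Rightarrow> 'a \<Rightarrow> 'a vwalk set" where
  "N2 G v = {p \<in> walks G. hd p = v \<and> vwalk_length p = 2}"

definition homotopy_covering ::
  "'a pair_pre_digraph \<Rightarrow> 'b pair_pre_digraph \<Rightarrow> ('a \<Rightarrow> 'b) \<Rightarrow> bool" where
  "homotopy_covering H G f \<longleftrightarrow>
     graph_morphism H G f \<and>
     (\<forall>v\<in>pverts H.
        bij_betw (map f) (N2 H v) (N2 G (f v)) \<and>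
        (\<forall>p\<in>N2 H v. \<forall>q\<in>N2 H v. last p = last q \<longleftrightarrow> last (map f p) = last (map f q)))"

inductive_set prune :: "'a pair_pre_digraph \<Rightarrow> 'a vwalk rel" for G where
  pruneI: "p @ [u, w, u] @ q \<in> walks G \<Longrightarrow> (p @ [u, w, u] @ q, p @ [u] @ q) \<in> prune G"

inductive_set spider :: "'a pair_pre_digraph \<Rightarrow> 'a vwalk rel" for G where
  spiderI: "p @ [u, x, w] @ q \<in> walks G \<Longrightarrow> (u, x') \<in> parcs G \<Longrightarrow> (x', w) \<in> parcs G \<Longrightarrow>
    (p @ [u, x, w] @ q, p @ [u, x', w] @ q) \<in> spider G"

text \<open>
  Every move preserves both endpoints of a walk, so equivalent walks have the same endpoints.
  The restriction only removes the reflexive pairs at lists that are not walks.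
\<close>

definition walk_equiv :: "'a pair_pre_digraph \<Rightarrow> 'a vwalk rel" where
  "walk_equiv G = Restr ((prune G \<union> (prune G)\<inverse> \<union> spider G)\<^sup>*) (walks G)"

definition walk_class :: "'a pair_pre_digraph \<Rightarrow> 'a vwalk \<Rightarrow> 'a vwalk set" where
  "walk_class G p = walk_equiv G `` {p}"

text \<open>
  The fundamental groupoid: \<open>fund_arrows G v w\<close> is the set of arrows from \<open>v\<close> to \<open>w\<close>, and
  \<open>arrow_comp G \<alpha> \<beta>\<close> is \<open>\<alpha>\<close> followed by \<open>\<beta>\<close>, meaningful when the target of \<open>\<alpha>\<close> is the
  source of \<open>\<beta>\<close>. For such walks \<open>p\<close> and \<open>q\<close>, the list \<open>p @ tl q\<close> is the concatenation.
\<close>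

definition fund_arrows :: "'a pair_pre_digraph \<Rightarrow> 'a \<Rightarrow> 'a \<Rightarrow> 'a vwalk set set" where
  "fund_arrows G v w = {p \<in> walks G. hd p = v \<and> last p = w} // walk_equiv G"

definition arrows_from :: "'a pair_pre_digraph \<Rightarrow> 'a \<Rightarrow> 'a vwalk set set" where
  "arrows_from G v = (\<Union>w\<in>pverts G. fund_arrows G v w)"

text \<open>The common endpoint of all walks in the class.\<close>

definition arrow_target :: "'a vwalk set \<Rightarrow> 'a" where
  "arrow_target \<alpha> = the_elem (last ` \<alpha>)"

definition arrow_comp ::
  "'a pair_pre_digraph \<Rightarrow> 'a vwalk set \<Rightarrow> 'a vwalk set \<Rightarrow> 'a vwalk set" where
  "arrow_comp G \<alpha> \<beta> = (\<Union>p\<in>\<alpha>. \<Union>q\<in>\<beta>. walk_class G (p @ tl q))"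

definition univ_cover :: "'a pair_pre_digraph \<Rightarrow> 'a \<Rightarrow> 'a vwalk set pair_pre_digraph" where
  "univ_cover G v =
     \<lparr> pverts = arrows_from G v,
       parcs = {(\<alpha>, \<beta>). \<alpha> \<in> arrows_from G v \<and> \<beta> \<in> arrows_from G v \<and>
         (\<exists>x. (arrow_target \<alpha>, x) \<in> parcs G \<and>
              \<beta> = arrow_comp G \<alpha> (walk_class G [arrow_target \<alpha>, x]))} \<rparr>"

abbreviation univ_proj :: "'a vwalk set \<Rightarrow> 'a" where
  "univ_proj \<equiv> arrow_target"


subsection \<open>The universal cover is a graph\<close>

lemma walks_append_iff:
  "p \<noteq> [] \<Longrightarrow> q \<noteq> [] \<Longrightarrow>
   p @ q \<in> walks G \<longleftrightarrow> p \<in> walks G \<and> q \<in> walks G \<and> (last p, hd q) \<in> parcs G"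
  by (auto simp: walks_def vwalk_def vwalk_arcs_append)

lemma walks_single [simp]: "[x] \<in> walks G \<longleftrightarrow> x \<in> pverts G"
  by (auto simp: walks_def vwalk_def)

lemma walks_not_Nil: "p \<in> walks G \<Longrightarrow> p \<noteq> []"
  by (auto simp: walks_def vwalk_def)

lemma walks_Cons2: "x # y # p \<in> walks G \<longleftrightarrow>
    x \<in> pverts G \<and> (x, y) \<in> parcs G \<and> y # p \<in> walks G"
  by (auto simp: walks_def vwalk_def)

lemma walks_hd_last:
  "p \<in> walks G \<Longrightarrow> hd p \<in> pverts G \<and> last p \<in> pverts G"
  by (auto simp: walks_def vwalk_def)

lemma walks_mid:
  "p @ u # q \<in> walks G \<longleftrightarrow> p @ [u] \<in> walks G \<and> u # q \<in> walks G"
proof (cases "p = []")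
  case True
  then show ?thesis by (cases q) (auto simp: walks_Cons2)
next
  case False
  show ?thesis
    using False walks_append_iff[of p "u # q" G] walks_append_iff[of p "[u]" G]
    by (cases q) (auto simp: walks_Cons2)
qed

context pair_sym_digraph
begin

abbreviation step :: "'a vwalk rel" where
  "step \<equiv> prune G \<union> (prune G)\<inverse> \<union> spider G"

lemma arcs_sym: "(x, y) \<in> parcs G \<Longrightarrow> (y, x) \<in> parcs G"
  using pair_sym_arcs by (auto simp: symmetric_def sym_def)

lemma prune_props:
  assumes "(p, q) \<in> prune G"
  shows "p \<in> walks G \<and> q \<in> walks G \<and> hd p = hd q \<and> last p = last q"
  using assms
proof cases
  case (pruneI a u w b)
  have "a @ [u] \<in> walks G" "u # b \<in> walks G"
    using pruneI(3) walks_mid[of a u "w # u # b" G] walks_mid[of "a @ [u, w]" u b G] by auto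
  then show ?thesis
    using pruneI walks_mid[of a u b G] by (cases a) auto
qed

lemma spider_props:
  assumes "(p, q) \<in> spider G"
  shows "p \<in> walks G \<and> q \<in> walks G \<and> hd p = hd q \<and> last p = last q \<and> (q, p) \<in> spider G"
  using assms
proof cases
  case (spiderI a u x w b x')
  have w: "a @ [u] \<in> walks G" "w # b \<in> walks G" "(u, x) \<in> parcs G" "(x, w) \<in> parcs G"
    using spiderI(3) walks_mid[of a u "x # w # b" G] by (auto simp: walks_Cons2)
  have q: "q \<in> walks G"
    using spiderI w walks_mid[of a u "x' # w # b" G] in_arcsD1 by (auto simp: walks_Cons2)
  have "(q, p) \<in> spider G"
    using spider.spiderI[of a u x' w b G x] q spiderI w by auto
  then show ?thesis using q spiderI by (cases a) auto
qed

lemma step_props: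
  "(p, q) \<in> step \<Longrightarrow>
   p \<in> walks G \<and> q \<in> walks G \<and> hd p = hd q \<and> last p = last q \<and> (q, p) \<in> step"
  by (elim UnE) (auto dest: prune_props spider_props)

lemma steps_endpoints:
  "(p, q) \<in> step\<^sup>* \<Longrightarrow> hd p = hd q \<and> last p = last q"
  by (induction rule: rtrancl_induct) (use step_props in auto)

lemma walk_equiv_endpoints:
  "(p, q) \<in> walk_equiv G \<Longrightarrow> p \<in> walks G \<and> q \<in> walks G \<and> hd p = hd q \<and> last p = last q"
  unfolding walk_equiv_def using steps_endpoints by blast

lemma equiv_walk_equiv: "equiv (walks G) (walk_equiv G)"
proof -
  have "sym step" using step_props by (auto intro: symI)
  then have "sym (step\<^sup>*)" by (rule sym_rtrancl)
  then show ?thesis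
    unfolding walk_equiv_def
    by (intro equivI) (auto simp: refl_on_def sym_def intro: transI rtrancl_trans)
qed

lemma step_append:
  assumes "(p, q) \<in> step" "r \<in> walks G" "last p = hd r"
  shows "(p @ tl r, q @ tl r) \<in> step"
proof -
  obtain u s where r: "r = u # s" using walks_not_Nil[OF assms(2)] by (cases r) auto
  have w: "t @ s \<in> walks G" if "t \<in> walks G" "last t = u" for t
  proof -
    have "t \<noteq> []" using walks_not_Nil that(1) by auto
    then have "t = butlast t @ [u]" using that(2) by (metis append_butlast_last_id)
    then show ?thesis using walks_mid[of "butlast t" u s G] that assms(2) r
      by (metis append.assoc append_Cons append_Nil)
  qed
  have "(a @ s, b @ s) \<in> prune G" if "(a, b) \<in> prune G" "last a = u" for a b
    using that(1)
  proof cases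
    case (pruneI c x y d)
    then show ?thesis using prune.pruneI[of c x y "d @ s" G] w[of a] that by auto
  qed
  moreover have "(a @ s, b @ s) \<in> spider G" if "(a, b) \<in> spider G" "last a = u" for a b
    using that(1)
  proof cases
    case (spiderI c x y z d y')
    then show ?thesis using spider.spiderI[of c x y z "d @ s" G y'] w[of a] that by auto
  qed
  ultimately show ?thesis
    using assms r step_props[OF assms(1)] by auto
qed

lemma step_prepend:
  assumes "(p, q) \<in> step" "r \<in> walks G" "last r = hd p"
  shows "(r @ tl p, r @ tl q) \<in> step"
proof -
  obtain u s where r: "r = s @ [u]"
    using walks_not_Nil[OF assms(2)] by (metis append_butlast_last_id)
  have e: "r @ tl t = s @ t" if "t \<noteq> []" "hd t = u" for t
    using that r by (cases t) auto
  have w: "s @ t \<in> walks G" if "t \<in> walks G" "hd t = u" for t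
    using walks_not_Nil[OF that(1)] walks_mid[of s u "tl t" G] assms(2) r that by (cases t) auto
  have "(s @ a, s @ b) \<in> prune G" if "(a, b) \<in> prune G" "hd a = u" for a b
    using that(1)
  proof cases
    case (pruneI c x y d)
    then show ?thesis using prune.pruneI[of "s @ c" x y d G] w[of a] that by auto
  qed
  moreover have "(s @ a, s @ b) \<in> spider G" if "(a, b) \<in> spider G" "hd a = u" for a b
    using that(1)
  proof cases
    case (spiderI c x y z d y')
    then show ?thesis using spider.spiderI[of "s @ c" x y z d G y'] w[of a] that by auto
  qed
  moreover have "p \<noteq> []" "q \<noteq> []" "hd p = u" "hd q = u"
    using step_props[OF assms(1)] walks_not_Nil assms(3) r by auto
  ultimately show ?thesis using e assms(1) by auto
qed

lemma walks_concat:
  assumes "p \<in> walks G" "q \<in> walks G" "last p = hd q"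
  shows "p @ tl q \<in> walks G" "hd (p @ tl q) = hd p" "last (p @ tl q) = last q"
proof -
  obtain u s where q: "q = u # s" using walks_not_Nil[OF assms(2)] by (cases q) auto
  obtain t where p: "p = t @ [u]"
    using walks_not_Nil[OF assms(1)] assms(3) q by (metis append_butlast_last_id list.sel(1))
  show "p @ tl q \<in> walks G" using walks_mid[of t u s G] assms p q by auto
  show "hd (p @ tl q) = hd p" using p by (cases t) auto
  show "last (p @ tl q) = last q" using p q by auto
qed

lemma walk_equiv_concat:
  assumes "(p, p') \<in> walk_equiv G" "(q, q') \<in> walk_equiv G" "last p = hd q"
  shows "(p @ tl q, p' @ tl q') \<in> walk_equiv G"
proof -
  have P: "p \<in> walks G" "p' \<in> walks G" "last p' = last p"
    and Q: "q \<in> walks G" "q' \<in> walks G" "hd q' = hd q"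
    using walk_equiv_endpoints assms by auto
  have "(p, p') \<in> step\<^sup>*" "(q, q') \<in> step\<^sup>*"
    using assms by (auto simp: walk_equiv_def)
  have "(p @ tl q, p' @ tl q) \<in> step\<^sup>*"
    using \<open>(p, p') \<in> step\<^sup>*\<close>
  proof (induction rule: rtrancl_induct)
    case (step y z)
    have "last y = hd q" using steps_endpoints[OF step(1)] assms(3) by auto
    then show ?case using step(3) step_append[OF step(2) Q(1)] by (meson rtrancl.rtrancl_into_rtrancl)
  qed simp
  moreover have "(p' @ tl q, p' @ tl q') \<in> step\<^sup>*"
    using \<open>(q, q') \<in> step\<^sup>*\<close>
  proof (induction rule: rtrancl_induct)
    case (step y z)
    have "last p' = hd y" using steps_endpoints[OF step(1)] assms(3) P by auto
    then show ?case using step(3) step_prepend[OF step(2) P(2)] by (meson rtrancl.rtrancl_into_rtrancl)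
  qed simp
  ultimately have "(p @ tl q, p' @ tl q') \<in> step\<^sup>*" by (rule rtrancl_trans)
  moreover have "p @ tl q \<in> walks G" "p' @ tl q' \<in> walks G"
    using walks_concat P Q assms by auto
  ultimately show ?thesis by (auto simp: walk_equiv_def)
qed

lemma walk_class_self: "p \<in> walks G \<Longrightarrow> p \<in> walk_class G p"
  unfolding walk_class_def using equiv_class_self[OF equiv_walk_equiv] by auto

lemma walk_class_eq: "(p, q) \<in> walk_equiv G \<Longrightarrow> walk_class G p = walk_class G q"
  unfolding walk_class_def using equiv_class_eq[OF equiv_walk_equiv] by auto

lemma arrow_target_class: "p \<in> walks G \<Longrightarrow> arrow_target (walk_class G p) = last p"
proof -
  assume p: "p \<in> walks G"
  have "last ` walk_class G p = {last p}"
  proof -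
    have "last q = last p" if "q \<in> walk_class G p" for q
      using walk_equiv_endpoints[of p q] that by (simp add: walk_class_def)
    then show ?thesis using walk_class_self[OF p] by blast
  qed
  then show ?thesis by (simp add: arrow_target_def)
qed

lemma arrow_comp_class:
  assumes "p \<in> walks G" "q \<in> walks G" "last p = hd q"
  shows "arrow_comp G (walk_class G p) (walk_class G q) = walk_class G (p @ tl q)"
proof -
  have "walk_class G (p' @ tl q') = walk_class G (p @ tl q)"
    if "p' \<in> walk_class G p" "q' \<in> walk_class G q" for p' q'
    using walk_class_eq[OF walk_equiv_concat[of p p' q q']] that assms by (auto simp: walk_class_def)
  then show ?thesis
    unfolding arrow_comp_def using walk_class_self assms by blast
qed

lemma arrows_from_eq: "arrows_from G v = walk_class G ` {p \<in> walks G. hd p = v}"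
  by (auto simp: arrows_from_def fund_arrows_def quotient_def walk_class_def
      dest: walks_hd_last)

lemma univ_cover_arc_iff:
  "(\<alpha>, \<beta>) \<in> parcs (univ_cover G v) \<longleftrightarrow>
   (\<exists>p x. p \<in> walks G \<and> hd p = v \<and> (last p, x) \<in> parcs G \<and>
          \<alpha> = walk_class G p \<and> \<beta> = walk_class G (p @ [x]))" (is "?L \<longleftrightarrow> ?R")
proof -
  have c: "arrow_comp G (walk_class G p) (walk_class G [last p, x]) = walk_class G (p @ [x])"
      "p @ [x] \<in> walks G" "hd (p @ [x]) = hd p"
    if "p \<in> walks G" "(last p, x) \<in> parcs G" for p x
  proof -
    have "[last p, x] \<in> walks G"
      using that in_arcsD1 in_arcsD2 by (auto simp: walks_Cons2)
    then show "arrow_comp G (walk_class G p) (walk_class G [last p, x]) = walk_class G (p @ [x])"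
      "p @ [x] \<in> walks G" "hd (p @ [x]) = hd p"
      using arrow_comp_class[of p "[last p, x]"] walks_concat[of p "[last p, x]"] that by auto
  qed
  show ?thesis
  proof
    assume ?L
    then obtain p x where h: "p \<in> walks G" "hd p = v" "\<alpha> = walk_class G p" "(last p, x) \<in> parcs G"
      "\<beta> = arrow_comp G \<alpha> (walk_class G [last p, x])"
      by (auto simp: univ_cover_def arrows_from_eq arrow_target_class)
    then show ?R using c(1)[OF h(1,4)] by blast
  next
    assume ?R
    then obtain p x where h: "p \<in> walks G" "hd p = v" "(last p, x) \<in> parcs G"
      "\<alpha> = walk_class G p" "\<beta> = walk_class G (p @ [x])" by blast
    then have "\<alpha> \<in> arrows_from G v" "\<beta> \<in> arrows_from G v"
      using c by (auto simp: arrows_from_eq)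
    then show ?L using h c
      by (auto simp: univ_cover_def arrow_target_class intro!: exI[of _ x])
  qed
qed

lemma pair_sym_digraph_univ_cover: "pair_sym_digraph (univ_cover G v)"
proof
  fix e assume "e \<in> parcs (univ_cover G v)"
  then show "fst e \<in> pverts (univ_cover G v)" "snd e \<in> pverts (univ_cover G v)"
    by (auto simp: univ_cover_def)
next
  have "(\<beta>, \<alpha>) \<in> parcs (univ_cover G v)" if arc: "(\<alpha>, \<beta>) \<in> parcs (univ_cover G v)" for \<alpha> \<beta>
  proof -
    obtain p x where h: "p \<in> walks G" "hd p = v" "(last p, x) \<in> parcs G"
      "\<alpha> = walk_class G p" "\<beta> = walk_class G (p @ [x])"
      using arc[unfolded univ_cover_arc_iff] by (elim exE conjE)
    have ne: "p \<noteq> []" using walks_not_Nil h by auto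
    have px: "p @ [x] \<in> walks G"
      using walks_append_iff[of p "[x]" G] ne h in_arcsD2 by auto
    have pxw: "p @ [x, last p] \<in> walks G"
      using walks_append_iff[of "p @ [x]" "[last p]" G] ne px h in_arcsD1 arcs_sym by auto
    have "(p @ [x, last p], p) \<in> prune G"
      using prune.pruneI[of "butlast p" "last p" x "[]" G] pxw ne
      by (metis append.assoc append_Cons append_Nil append_Nil2 append_butlast_last_id)
    then have "(p @ [x, last p], p) \<in> walk_equiv G"
      using pxw h by (auto simp: walk_equiv_def)
    then have "\<alpha> = walk_class G ((p @ [x]) @ [last p])"
      using walk_class_eq h by auto
    then show ?thesis
      unfolding univ_cover_arc_iff using h px ne arcs_sym
      by (intro exI[of _ "p @ [x]"] exI[of _ "last p"]) auto
  qed
  then show "symmetric (with_proj (univ_cover G v))"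
    by (auto simp: symmetric_def sym_def)
qed

end

lemma (in htpy_graph) neighbour_exists:
  assumes "v \<in> pverts G"
  shows "\<exists>x. (v, x) \<in> parcs G"
proof (cases "pverts G = {v}")
  case True
  then have "parcs G \<noteq> {}" using not_isolated_vertex by blast
  then obtain e where "e \<in> parcs G" by blast
  then have "fst e = v" using arc_fst_in_verts True by blast
  then show ?thesis using \<open>e \<in> parcs G\<close> by (metis prod.collapse)
next
  case False
  then obtain w where w: "w \<in> pverts G" "w \<noteq> v" using assms by blast
  have "strongly_connected (with_proj G)"
    using symmetric_connected_imp_strongly_connected pair_sym_arcs connected by auto
  then have "v \<rightarrow>\<^sup>*\<^bsub>with_proj G\<^esub> w" using w assms by (auto simp: strongly_connected_def)
  then have "(v, w) \<in> (parcs G)\<^sup>*"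
    by (metis reachable_def rtrancl_on_rtranclI with_proj_simps(3))
  then show ?thesis using w by (metis converse_rtranclE)
qed

text \<open>
  The standing assumptions on graphs therefore hold for the universal homotopy cover as well.
\<close>

theorem (in htpy_graph) htpy_graph_univ_cover:
  assumes v: "v \<in> pverts G"
  shows "htpy_graph (univ_cover G v)"
proof -
  let ?U = "univ_cover G v"
  interpret U: pair_sym_digraph ?U by (rule pair_sym_digraph_univ_cover)
  have verts: "pverts ?U = walk_class G ` {p \<in> walks G. hd p = v}"
    by (simp add: univ_cover_def arrows_from_eq)
  have base: "walk_class G [v] \<in> pverts ?U" using v by (auto simp: verts)
  have reach: "walk_class G [v] \<rightarrow>\<^sup>*\<^bsub>with_proj ?U\<^esub> walk_class G p"
    if "p \<in> walks G" "hd p = v" for p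
    using that
  proof (induction p rule: rev_induct)
    case Nil
    then show ?case using walks_not_Nil by blast
  next
    case (snoc x p)
    show ?case
    proof (cases "p = []")
      case True
      then show ?thesis using snoc base by (auto intro: U.reachable_refl)
    next
      case False
      then have p: "p \<in> walks G" "(last p, x) \<in> parcs G" "hd p = v"
        using walks_append_iff[of p "[x]" G] snoc by auto
      then have "(walk_class G p, walk_class G (p @ [x])) \<in> parcs ?U"
        unfolding univ_cover_arc_iff by (intro exI[of _ p] exI[of _ x]) auto
      then show ?thesis using snoc.IH p
        by (metis U.reachable_adj_trans with_proj_simps(3))
    qed
  qed
  have "strongly_connected (with_proj ?U)"
    unfolding strongly_connected_def
  proof (intro conjI ballI)
    show "verts (with_proj ?U) \<noteq> {}" using base by auto
    fix \<alpha> \<beta> assume "\<alpha> \<in> verts (with_proj ?U)" "\<beta> \<in> verts (with_proj ?U)"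
    then have "walk_class G [v] \<rightarrow>\<^sup>*\<^bsub>with_proj ?U\<^esub> \<alpha>" "walk_class G [v] \<rightarrow>\<^sup>*\<^bsub>with_proj ?U\<^esub> \<beta>"
      using reach by (auto simp: verts)
    then show "\<alpha> \<rightarrow>\<^sup>*\<^bsub>with_proj ?U\<^esub> \<beta>"
      using symmetric_reachable[OF U.pair_sym_arcs] U.reachable_trans by metis
  qed
  then have "Digraph_Component.connected (with_proj ?U)"
    unfolding connected_def strongly_connected_def
    using U.reachable_mk_symmetric_eq[OF U.pair_sym_arcs] by simp
  moreover obtain x where "(v, x) \<in> parcs G" using neighbour_exists[OF v] by blast
  then have "(walk_class G [v], walk_class G ([v] @ [x])) \<in> parcs ?U"
    unfolding univ_cover_arc_iff using v by (intro exI[of _ "[v]"] exI[of _ x]) auto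
  ultimately show ?thesis by unfold_locales auto
qed

end

theory Submission
  imports Defs
begin

text \<open>
  Since \<open>f\<close> is bijective on walks of length 2 and respects their endpoints, walks and the moves
  between them lift uniquely through \<open>f\<close>. Hence the endpoint of the lift at \<open>vt\<close> of a walk from
  \<open>v\<close> depends only on the class of the walk, and this endpoint is \<open>\<rho>t\<close>. That \<open>\<rho>t\<close> is a homotopy
  covering follows by two-out-of-three from the fact that \<open>\<rho>\<close> and \<open>f\<close> are.
\<close>

section \<open>The arcs of the universal cover, its walks of length 2, and its projection\<close>

context pair_sym_digraph
begin

lemma N2_eq: "N2 G v = {[v, x, y] | x y. (v, x) \<in> parcs G \<and> (x, y) \<in> parcs G}"
proof (intro set_eqI iffI)
  fix p assume p: "p \<in> N2 G v"
  then have "length p = 3" by (auto simp: N2_def)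
  then obtain a x y where "p = [a, x, y]"
    by (auto simp: numeral_3_eq_3 length_Suc_conv)
  then show "p \<in> {[v, x, y] | x y. (v, x) \<in> parcs G \<and> (x, y) \<in> parcs G}"
    using p by (auto simp: N2_def walks_Cons2)
qed (auto simp: N2_def walks_Cons2 dest: in_arcsD1 in_arcsD2)

lemma walks_snoc_iff:
  "p \<noteq> [] \<Longrightarrow> p @ [x] \<in> walks G \<longleftrightarrow> p \<in> walks G \<and> (last p, x) \<in> parcs G"
  using walks_append_iff[of p "[x]" G] in_arcsD2 by auto

lemma walks_snoc:
  "p \<in> walks G \<Longrightarrow> (last p, x) \<in> parcs G \<Longrightarrow> p @ [x] \<in> walks G \<and> hd (p @ [x]) = hd p"
  using walks_snoc_iff[of p x] walks_not_Nil[of p G] by simp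

text \<open>Equivalence is a congruence for concatenation, here applied to the one-edge walk
  \<open>[last p, x]\<close>. Extending an arrow by an edge thus does not depend on the walk that
  represents it.\<close>

lemma walk_class_snoc:
  assumes "p \<in> walks G" "q \<in> walks G" "walk_class G p = walk_class G q" "(last p, x) \<in> parcs G"
  shows "walk_class G (p @ [x]) = walk_class G (q @ [x])"
proof -
  have pq: "(p, q) \<in> walk_equiv G"
    using walk_class_self[OF assms(2)] assms(3) by (auto simp: walk_class_def)
  have "[last p, x] \<in> walks G"
    using assms(4) in_arcsD1 in_arcsD2 by (auto simp: walks_Cons2)
  then have "([last p, x], [last p, x]) \<in> walk_equiv G"
    by (auto simp: walk_equiv_def)
  from walk_class_eq[OF walk_equiv_concat[OF pq this]] show ?thesis by simp
qed

text \<open>The two walks differ by one spider move at the vertex before the end. This is why two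
  length 2 walks of the universal cover that leave one vertex meet again as soon as their
  projections do.\<close>

lemma walk_class_spider:
  assumes "p \<in> walks G" "(last p, x) \<in> parcs G" "(x, y) \<in> parcs G"
    "(last p, x') \<in> parcs G" "(x', y) \<in> parcs G"
  shows "walk_class G (p @ [x, y]) = walk_class G (p @ [x', y])"
proof -
  \<comment> \<open>Exposes the last vertex of \<open>p\<close>, which is the fixed left neighbour
    of the vertex moved by the spider move.\<close>
  have split: "p @ s = butlast p @ [last p] @ s" for s
    using walks_not_Nil[OF assms(1)] by simp
  have w: "p @ [x, y] \<in> walks G"
    using walks_snoc[of "p @ [x]" y] walks_snoc[of p x] assms by auto
  have sp: "(p @ [x, y], p @ [x', y]) \<in> spider G"
    using spider.spiderI[of "butlast p" "last p" x y "[]" G x'] w assms(4,5) unfolding split by simp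
  then have "p @ [x', y] \<in> walks G" using spider_props by blast
  with w sp have "(p @ [x, y], p @ [x', y]) \<in> walk_equiv G"
    by (simp add: walk_equiv_def r_into_rtrancl)
  then show ?thesis by (rule walk_class_eq)
qed

lemma pverts_univ_cover: "pverts (univ_cover G v) = walk_class G ` {p \<in> walks G. hd p = v}"
  by (simp add: univ_cover_def arrows_from_eq)

text \<open>\<open>univ_cover_arc_iff\<close> only provides some representative of the source,
  possibly a different one for each arc. By \<open>walk_class_snoc\<close> it may be traded for a
  prescribed \<open>p\<close>, so that consecutive arcs can be described by extending one and the
  same walk.\<close>

lemma univ_cover_arc_from_class_iff:
  assumes "p \<in> walks G" "hd p = v"
  shows "(walk_class G p, \<beta>) \<in> parcs (univ_cover G v) \<longleftrightarrow>
    (\<exists>x. (last p, x) \<in> parcs G \<and> \<beta> = walk_class G (p @ [x]))"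
proof
  assume "(walk_class G p, \<beta>) \<in> parcs (univ_cover G v)"
  then obtain q x where q: "q \<in> walks G" "(last q, x) \<in> parcs G"
    "walk_class G p = walk_class G q" "\<beta> = walk_class G (q @ [x])"
    unfolding univ_cover_arc_iff by blast
  moreover have "last p = last q"
    using arrow_target_class assms(1) q by metis
  ultimately show "\<exists>x. (last p, x) \<in> parcs G \<and> \<beta> = walk_class G (p @ [x])"
    using walk_class_snoc[OF assms(1) q(1) q(3)] by auto
next
  assume "\<exists>x. (last p, x) \<in> parcs G \<and> \<beta> = walk_class G (p @ [x])"
  then show "(walk_class G p, \<beta>) \<in> parcs (univ_cover G v)"
    unfolding univ_cover_arc_iff using assms by blast
qed

text \<open>Two uses of the previous lemma, for \<open>p\<close> and for \<open>p @ [x]\<close>. The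
  index set is that of \<open>N2 G (last p)\<close> in \<open>N2_eq\<close>, which makes the
  bijection under the projection visible.\<close>

lemma N2_univ_cover:
  assumes "p \<in> walks G" "hd p = v"
  shows "N2 (univ_cover G v) (walk_class G p) =
    {[walk_class G p, walk_class G (p @ [x]), walk_class G (p @ [x, y])] | x y.
      (last p, x) \<in> parcs G \<and> (x, y) \<in> parcs G}" (is "?L = ?R")
proof -
  interpret U: pair_sym_digraph "univ_cover G v" by (rule pair_sym_digraph_univ_cover)
  have *: "(walk_class G (p @ [x]), \<gamma>) \<in> parcs (univ_cover G v) \<longleftrightarrow>
      (\<exists>y. (x, y) \<in> parcs G \<and> \<gamma> = walk_class G (p @ [x, y]))" if "(last p, x) \<in> parcs G" for x \<gamma>
    using univ_cover_arc_from_class_iff[of "p @ [x]" v \<gamma>] walks_snoc[OF assms(1) that] assms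
    by auto
  show ?thesis
  proof (intro set_eqI iffI)
    fix s assume "s \<in> ?L"
    then obtain \<beta> \<gamma> where s: "s = [walk_class G p, \<beta>, \<gamma>]"
      "(walk_class G p, \<beta>) \<in> parcs (univ_cover G v)" "(\<beta>, \<gamma>) \<in> parcs (univ_cover G v)"
      unfolding U.N2_eq by blast
    then obtain x where x: "(last p, x) \<in> parcs G" "\<beta> = walk_class G (p @ [x])"
      using univ_cover_arc_from_class_iff[OF assms] by blast
    then show "s \<in> ?R" using s *[OF x(1)] by blast
  next
    fix s assume "s \<in> ?R"
    then obtain x y where x: "(last p, x) \<in> parcs G" "(x, y) \<in> parcs G"
      "s = [walk_class G p, walk_class G (p @ [x]), walk_class G (p @ [x, y])]" by blast
    have "(walk_class G p, walk_class G (p @ [x])) \<in> parcs (univ_cover G v)"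
      using univ_cover_arc_from_class_iff[OF assms] x(1) by blast
    moreover have "(walk_class G (p @ [x]), walk_class G (p @ [x, y])) \<in> parcs (univ_cover G v)"
      using *[OF x(1)] x(2) by blast
    ultimately show "s \<in> ?L" by (simp add: U.N2_eq x(3))
  qed
qed

text \<open>Walks of length 2 above and below are indexed by the same pairs \<open>x\<close>,
  \<open>y\<close>, and the projection reads these off as targets; this gives the bijection. Equal
  ends above have equal targets, and the converse is \<open>walk_class_spider\<close>.\<close>

theorem homotopy_covering_univ_proj: "homotopy_covering (univ_cover G v) G univ_proj"
  unfolding homotopy_covering_def
proof (intro conjI ballI)
  show "graph_morphism (univ_cover G v) G univ_proj"
    unfolding graph_morphism_def pverts_univ_cover
  proof (intro conjI ballI allI impI)
    fix \<alpha> assume "\<alpha> \<in> walk_class G ` {p \<in> walks G. hd p = v}"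
    then obtain p where "p \<in> walks G" "\<alpha> = walk_class G p" by blast
    then show "univ_proj \<alpha> \<in> pverts G" using arrow_target_class walks_hd_last[of p G] by simp
  next
    fix \<alpha> \<beta> assume "(\<alpha>, \<beta>) \<in> parcs (univ_cover G v)"
    then obtain p x where p: "p \<in> walks G" "(last p, x) \<in> parcs G"
      "\<alpha> = walk_class G p" "\<beta> = walk_class G (p @ [x])"
      unfolding univ_cover_arc_iff by (elim exE conjE)
    then show "(univ_proj \<alpha>, univ_proj \<beta>) \<in> parcs G"
      using arrow_target_class walks_snoc[OF p(1,2)] by simp
  qed
next
  fix \<alpha> assume "\<alpha> \<in> pverts (univ_cover G v)"
  then obtain p where p: "p \<in> walks G" "hd p = v" and \<alpha>: "\<alpha> = walk_class G p"
    by (auto simp: pverts_univ_cover)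
  have target: "univ_proj \<alpha> = last p"
    using p \<alpha> arrow_target_class by simp
  have targets: "univ_proj (walk_class G (p @ [x])) = x" "univ_proj (walk_class G (p @ [x, y])) = y"
    if "(last p, x) \<in> parcs G" "(x, y) \<in> parcs G" for x y
  proof -
    have "p @ [x] \<in> walks G" using walks_snoc[OF p(1) that(1)] by simp
    moreover have "p @ [x, y] \<in> walks G" using walks_snoc[OF calculation, of y] that(2) by simp
    ultimately show "univ_proj (walk_class G (p @ [x])) = x"
      "univ_proj (walk_class G (p @ [x, y])) = y"
      using arrow_target_class by simp_all
  qed
  note N2 = N2_univ_cover[OF p, folded \<alpha>]
  have N2E: thesis
    if "s \<in> N2 (univ_cover G v) \<alpha>"
      "\<And>x y. (last p, x) \<in> parcs G \<Longrightarrow> (x, y) \<in> parcs G \<Longrightarrow>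
        s = [\<alpha>, walk_class G (p @ [x]), walk_class G (p @ [x, y])] \<Longrightarrow> thesis" for s thesis
    using that unfolding N2 mem_Collect_eq by (elim exE conjE)
  show "bij_betw (map univ_proj) (N2 (univ_cover G v) \<alpha>) (N2 G (univ_proj \<alpha>))"
    unfolding target
  proof (rule bij_betw_imageI)
    show "inj_on (map univ_proj) (N2 (univ_cover G v) \<alpha>)"
    proof (rule inj_onI)
      fix s t
      assume "s \<in> N2 (univ_cover G v) \<alpha>" "t \<in> N2 (univ_cover G v) \<alpha>"
        and eq: "map univ_proj s = map univ_proj t"
      obtain x y where s: "(last p, x) \<in> parcs G" "(x, y) \<in> parcs G"
        "s = [\<alpha>, walk_class G (p @ [x]), walk_class G (p @ [x, y])]"
        using \<open>s \<in> _\<close> by (rule N2E)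
      obtain x' y' where t: "(last p, x') \<in> parcs G" "(x', y') \<in> parcs G"
        "t = [\<alpha>, walk_class G (p @ [x']), walk_class G (p @ [x', y'])]"
        using \<open>t \<in> _\<close> by (rule N2E)
      show "s = t" using s(3) t(3) eq targets[OF s(1,2)] targets[OF t(1,2)] by simp
    qed
    show "map univ_proj ` N2 (univ_cover G v) \<alpha> = N2 G (last p)"
    proof (intro set_eqI iffI)
      fix s assume "s \<in> map univ_proj ` N2 (univ_cover G v) \<alpha>"
      then obtain s' where s': "s' \<in> N2 (univ_cover G v) \<alpha>" "s = map univ_proj s'" by blast
      from s'(1) show "s \<in> N2 G (last p)"
        by (rule N2E) (simp add: s'(2) N2_eq target targets)
    next
      fix s assume "s \<in> N2 G (last p)"
      then obtain x y where xy: "(last p, x) \<in> parcs G" "(x, y) \<in> parcs G" "s = [last p, x, y]"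
        unfolding N2_eq by blast
      have "[\<alpha>, walk_class G (p @ [x]), walk_class G (p @ [x, y])] \<in> N2 (univ_cover G v) \<alpha>"
        unfolding N2 using xy(1,2) by blast
      then show "s \<in> map univ_proj ` N2 (univ_cover G v) \<alpha>"
        by (rule rev_image_eqI) (simp add: target targets[OF xy(1,2)] xy(3))
    qed
  qed
  fix s t assume "s \<in> N2 (univ_cover G v) \<alpha>" "t \<in> N2 (univ_cover G v) \<alpha>"
  obtain x y where s: "(last p, x) \<in> parcs G" "(x, y) \<in> parcs G"
    "s = [\<alpha>, walk_class G (p @ [x]), walk_class G (p @ [x, y])]"
    using \<open>s \<in> _\<close> by (rule N2E)
  obtain x' y' where t: "(last p, x') \<in> parcs G" "(x', y') \<in> parcs G"
    "t = [\<alpha>, walk_class G (p @ [x']), walk_class G (p @ [x', y'])]"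
    using \<open>t \<in> _\<close> by (rule N2E)
  have last: "last s = walk_class G (p @ [x, y])" "last t = walk_class G (p @ [x', y'])"
    "last (map univ_proj s) = y" "last (map univ_proj t) = y'"
    using s(3) t(3) targets[OF s(1,2)] targets[OF t(1,2)] by simp_all
  show "last s = last t \<longleftrightarrow> last (map univ_proj s) = last (map univ_proj t)"
  proof
    assume "last s = last t"
    then show "last (map univ_proj s) = last (map univ_proj t)"
      using last targets(2)[OF s(1,2)] targets(2)[OF t(1,2)] by metis
  next
    assume "last (map univ_proj s) = last (map univ_proj t)"
    then have "y = y'" using last by simp
    then show "last s = last t"
      using walk_class_spider[OF p(1) s(1,2) t(1)] t(2) last by metis
  qed
qed

end

section \<open>Morphisms acting on walks, and cancellation of homotopy coverings\<close>

lemma graph_morphismD: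
  "graph_morphism G H f \<Longrightarrow> (x, y) \<in> parcs G \<Longrightarrow> (f x, f y) \<in> parcs H"
  by (auto simp: graph_morphism_def)

lemma graph_morphism_walks:
  "graph_morphism G H f \<Longrightarrow> p \<in> walks G \<Longrightarrow> map f p \<in> walks H"
proof (induction p rule: induct_list012)
  case (3 x y zs)
  then show ?case by (auto simp: walks_Cons2 graph_morphism_def)
qed (auto simp: graph_morphism_def dest: walks_not_Nil)

text \<open>On walks of length 2 the map of \<open>g\<close> is that of \<open>h\<close> followed by
  that of \<open>f\<close>. Two of the three are bijections that respect endpoints, hence so is the
  remaining one.\<close>

lemma homotopy_covering_cancel_left:
  assumes f: "homotopy_covering H G f" and g: "homotopy_covering K G g"
    and h: "graph_morphism K H h" and "pair_sym_digraph K"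
    and fh: "\<And>x. x \<in> pverts K \<Longrightarrow> g x = f (h x)"
  shows "homotopy_covering K H h"
  unfolding homotopy_covering_def
proof (intro conjI ballI h)
  interpret K: pair_sym_digraph K by fact
  fix v assume v: "v \<in> pverts K"
  have hv: "h v \<in> pverts H" using h v by (auto simp: graph_morphism_def)
  have N2_h: "map h p \<in> N2 H (h v)" if "p \<in> N2 K v" for p
    using that graph_morphism_walks[OF h, of p] walks_not_Nil[of p K]
    by (auto simp: N2_def hd_map)
  \<comment> \<open>The factorisation \<open>fh\<close> holds on vertices only, so all three entries
    of the walk have to be recognised as vertices of \<open>K\<close>.\<close>
  have comp: "map g p = map f (map h p)" if "p \<in> N2 K v" for p
    using that v fh K.in_arcsD1 K.in_arcsD2 unfolding K.N2_eq by auto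
  have "bij_betw (map g) (N2 K v) (N2 G (f (h v)))"
    using g v fh by (auto simp: homotopy_covering_def)
  then have gbij: "bij_betw (map f \<circ> map h) (N2 K v) (N2 G (f (h v)))"
    by (rule iffD1[OF bij_betw_cong, rotated]) (use comp in auto)
  have fbij: "bij_betw (map f) (N2 H (h v)) (N2 G (f (h v)))"
    using f hv by (auto simp: homotopy_covering_def)
  show "bij_betw (map h) (N2 K v) (N2 H (h v))"
    using bij_betw_comp_iff2[OF fbij, of "map h" "N2 K v"] N2_h gbij by blast
  fix p q assume pq: "p \<in> N2 K v" "q \<in> N2 K v"
  have "last p = last q \<longleftrightarrow> last (map g p) = last (map g q)"
    using g v pq by (auto simp: homotopy_covering_def)
  also have "\<dots> \<longleftrightarrow> last (map h p) = last (map h q)"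
    unfolding comp[OF pq(1)] comp[OF pq(2)]
    using f hv N2_h[OF pq(1)] N2_h[OF pq(2)] unfolding homotopy_covering_def by blast
  finally show "last p = last q \<longleftrightarrow> last (map h p) = last (map h q)" .
qed

section \<open>Unique lifting of arcs, walks and moves along a homotopy covering\<close>

locale htpy_cover =
  G: pair_sym_digraph G + H: pair_sym_digraph H
  for G :: "'a pair_pre_digraph" and H :: "'b pair_pre_digraph" +
  fixes f :: "'b \<Rightarrow> 'a"
  assumes cov: "homotopy_covering H G f"
begin

lemma morphism: "graph_morphism H G f"
  using cov by (simp add: homotopy_covering_def)

text \<open>The covering condition speaks of length 2 only, so each arc is traversed there and back:
  \<open>[a, b, a]\<close> and \<open>[a, c, a]\<close> have the same image, and injectivity on
  \<open>N2 H a\<close> applies.\<close>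

lemma arc_lift_unique:
  assumes "(a, b) \<in> parcs H" "(a, c) \<in> parcs H" "f b = f c"
  shows "b = c"
proof -
  have "inj_on (map f) (N2 H a)"
    using cov assms(1) H.in_arcsD1 by (auto simp: homotopy_covering_def bij_betw_def)
  moreover have "map f [a, b, a] = map f [a, c, a]" using assms(3) by simp
  moreover have "[a, b, a] \<in> N2 H a" "[a, c, a] \<in> N2 H a"
    using assms H.arcs_sym by (auto simp: H.N2_eq)
  ultimately have "[a, b, a] = [a, c, a]" by (rule inj_onD)
  then show ?thesis by simp
qed

lemma N2_lift_exists:
  assumes "a \<in> pverts H" "(f a, x) \<in> parcs G" "(x, y) \<in> parcs G"
  obtains b c where "(a, b) \<in> parcs H" "(b, c) \<in> parcs H" "f b = x" "f c = y"
proof -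
  have "[f a, x, y] \<in> N2 G (f a)" using assms by (auto simp: G.N2_eq)
  then have "[f a, x, y] \<in> map f ` N2 H a"
    using cov assms(1) by (auto simp: homotopy_covering_def bij_betw_def)
  then show thesis using that by (auto simp: H.N2_eq)
qed

text \<open>Lift the walk that goes to \<open>x\<close> and returns to \<open>f a\<close>, then
  forget its last vertex.\<close>

lemma arc_lift_exists:
  assumes "a \<in> pverts H" "(f a, x) \<in> parcs G"
  obtains b where "(a, b) \<in> parcs H" "f b = x"
  using N2_lift_exists[OF assms(1,2) G.arcs_sym[OF assms(2)]] by metis

text \<open>The other route from \<open>f a\<close> to \<open>f c\<close> lifts to a walk from
  \<open>a\<close> whose end lies over \<open>f c\<close>. Respect for endpoints forces this end to
  be \<open>c\<close> itself. This is what makes spider moves lift.\<close>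

lemma diamond_lift:
  assumes "(a, b) \<in> parcs H" "(b, c) \<in> parcs H" "(f a, x) \<in> parcs G" "(x, f c) \<in> parcs G"
  obtains b' where "(a, b') \<in> parcs H" "(b', c) \<in> parcs H" "f b' = x"
proof -
  have a: "a \<in> pverts H" using assms(1) H.in_arcsD1 by auto
  obtain b' c' where b': "(a, b') \<in> parcs H" "(b', c') \<in> parcs H" "f b' = x" "f c' = f c"
    using N2_lift_exists[OF a assms(3,4)] by blast
  have "[a, b, c] \<in> N2 H a" "[a, b', c'] \<in> N2 H a" using b' assms by (auto simp: H.N2_eq)
  moreover have "last (map f [a, b, c]) = last (map f [a, b', c'])" using b' by simp
  ultimately have "last [a, b, c] = last [a, b', c']"
    using cov a unfolding homotopy_covering_def by blast
  then show thesis using that b' by simp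
qed

lemma walk_lift_exists:
  assumes "p \<in> walks G" "a \<in> pverts H" "hd p = f a"
  obtains q where "q \<in> walks H" "hd q = a" "map f q = p"
proof -
  have "\<exists>q\<in>walks H. hd q = a \<and> map f q = p"
    using assms(1,3)
  proof (induction p rule: rev_induct)
    case Nil
    then show ?case using walks_not_Nil by blast
  next
    case (snoc x p)
    show ?case
    proof (cases "p = []")
      case True
      then show ?thesis using snoc.prems assms(2) by (intro bexI[of _ "[a]"]) auto
    next
      case False
      then have p: "p \<in> walks G" "(last p, x) \<in> parcs G" "hd p = f a"
        using G.walks_snoc_iff snoc.prems by auto
      then obtain q where q: "q \<in> walks H" "hd q = a" "map f q = p" using snoc.IH by blast
      have "f (last q) = last p" using q walks_not_Nil last_map by metis
      then obtain b where b: "(last q, b) \<in> parcs H" "f b = x"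
        using arc_lift_exists[of "last q" x] walks_hd_last[OF q(1)] p by auto
      then show ?thesis using H.walks_snoc[OF q(1) b(1)] q
        by (intro bexI[of _ "q @ [b]"]) auto
    qed
  qed
  then show thesis using that by blast
qed

text \<open>From the common first vertex onwards, \<open>arc_lift_unique\<close> determines each
  next vertex.\<close>

lemma walk_lift_unique:
  "p \<in> walks H \<Longrightarrow> q \<in> walks H \<Longrightarrow> hd p = hd q \<Longrightarrow> map f p = map f q \<Longrightarrow> p = q"
proof (induction p arbitrary: q rule: induct_list012)
  case (3 x y zs)
  then obtain y' zs' where q: "q = x # y' # zs'"
    by (auto simp: map_eq_Cons_conv Cons_eq_map_conv)
  have "y = y'"
    using 3(3-) q arc_lift_unique[of x y y'] by (auto simp: walks_Cons2)
  then show ?case using 3(2)[of "y' # zs'"] 3(3-) q by (auto simp: walks_Cons2)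
qed (auto dest: walks_not_Nil)

text \<open>In the lift, the two visits to \<open>u\<close> could a priori be different vertices
  \<open>u1\<close> and \<open>u2\<close>. Both are neighbours of \<open>w1\<close> over
  \<open>u\<close>, so unique lifting of arcs at \<open>w1\<close> identifies them and the lift can
  be pruned as well.\<close>

lemma prune_lift:
  assumes "(p, p') \<in> prune G" "q \<in> walks H" "map f q = p"
  obtains q' where "(q, q') \<in> prune H" "map f q' = p'"
  using assms(1)
proof cases
  case (pruneI r u w s)
  then obtain a u1 w1 u2 b where q: "q = a @ [u1, w1, u2] @ b"
    and f: "map f a = r" "f u1 = u" "f w1 = w" "f u2 = u" "map f b = s"
    using assms(3) by (auto simp: map_eq_append_conv map_eq_Cons_conv)
  have "(u1, w1) \<in> parcs H" "(w1, u2) \<in> parcs H"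
    using assms(2) walks_mid[of a u1 "w1 # u2 # b" H] by (auto simp: q walks_Cons2)
  then have "u1 = u2" using arc_lift_unique[of w1 u1 u2] H.arcs_sym f by auto
  then show thesis
    using that[of "a @ [u1] @ b"] prune.pruneI[of a u1 w1 b H] assms(2) q f pruneI by auto
qed

text \<open>The detour to insert comes from lifting the arc from \<open>u\<close> to
  \<open>w\<close> at the vertex \<open>u1\<close> of the lift; the way back exists by
  symmetry.\<close>

lemma prune_converse_lift:
  assumes "(p', p) \<in> prune G" "q \<in> walks H" "map f q = p"
  obtains q' where "(q', q) \<in> prune H" "map f q' = p'"
  using assms(1)
proof cases
  case (pruneI r u w s)
  then obtain a u1 b where q: "q = a @ u1 # b"
    and f: "map f a = r" "f u1 = u" "map f b = s"
    using assms(3) by (auto simp: map_eq_append_conv map_eq_Cons_conv)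
  have "a @ [u1] \<in> walks H" and b: "u1 # b \<in> walks H"
    using assms(2) walks_mid[of a u1 b H] by (auto simp: q)
  moreover have "u1 \<in> pverts H" using walks_hd_last[OF b] by simp
  moreover have "(u, w) \<in> parcs G"
    using pruneI(3) walks_mid[of r u "w # u # s" G] by (auto simp: walks_Cons2)
  ultimately obtain w1 where w1: "(u1, w1) \<in> parcs H" "f w1 = w"
    using arc_lift_exists f by metis
  then have "a @ [u1, w1, u1] @ b \<in> walks H"
    using \<open>a @ [u1] \<in> walks H\<close> b H.arcs_sym walks_mid[of a u1 "w1 # u1 # b" H] H.in_arcsD1
      H.in_arcsD2
    by (auto simp: walks_Cons2)
  then show thesis
    using that[of "a @ [u1, w1, u1] @ b"] prune.pruneI[of a u1 w1 b H] q f w1 pruneI by auto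
qed

lemma spider_lift:
  assumes "(p, p') \<in> spider G" "q \<in> walks H" "map f q = p"
  obtains q' where "(q, q') \<in> spider H" "map f q' = p'"
  using assms(1)
proof cases
  case (spiderI r u x w s x')
  then obtain a u1 x1 w1 b where q: "q = a @ [u1, x1, w1] @ b"
    and f: "map f a = r" "f u1 = u" "f x1 = x" "f w1 = w" "map f b = s"
    using assms(3) by (auto simp: map_eq_append_conv map_eq_Cons_conv)
  have "(u1, x1) \<in> parcs H" "(x1, w1) \<in> parcs H"
    using assms(2) walks_mid[of a u1 "x1 # w1 # b" H] by (auto simp: q walks_Cons2)
  then obtain x2 where "(u1, x2) \<in> parcs H" "(x2, w1) \<in> parcs H" "f x2 = x'"
    using diamond_lift f spiderI(4,5) by metis
  then show thesis
    using that[of "a @ [u1, x2, w1] @ b"] spider.spiderI[of a u1 x1 w1 b H x2] assms(2) q f spiderI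
    by auto
qed

lemma step_lift:
  assumes "(p, p') \<in> G.step" "q \<in> walks H" "map f q = p"
  obtains q' where "(q, q') \<in> H.step" "map f q' = p'"
  using assms(1)
proof (elim UnE)
  assume "(p, p') \<in> prune G"
  from prune_lift[OF this assms(2,3)] show thesis using that by blast
next
  assume "(p, p') \<in> (prune G)\<inverse>"
  then have "(p', p) \<in> prune G" by simp
  from prune_converse_lift[OF this assms(2,3)] show thesis using that by blast
next
  assume "(p, p') \<in> spider G"
  from spider_lift[OF this assms(2,3)] show thesis using that by blast
qed

text \<open>Every move below is matched by a move above, and moves above keep both endpoints. This
  is homotopy lifting: equivalent walks have lifts that start together and end together.\<close>

lemma walk_equiv_lift:
  assumes "(p, p') \<in> walk_equiv G" "q \<in> walks H" "map f q = p"
  obtains q' where "q' \<in> walks H" "hd q' = hd q" "last q' = last q" "map f q' = p'"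
proof -
  have "(p, p') \<in> G.step\<^sup>*" using assms(1) by (simp add: walk_equiv_def)
  then have "\<exists>q'\<in>walks H. hd q' = hd q \<and> last q' = last q \<and> map f q' = p'"
  proof (induction rule: rtrancl_induct)
    case base
    then show ?case using assms by blast
  next
    case (step y z)
    then obtain q' where q': "q' \<in> walks H" "hd q' = hd q" "last q' = last q" "map f q' = y"
      by blast
    obtain q'' where q'': "(q', q'') \<in> H.step" "map f q'' = z"
      using step_lift[OF step(2) q'(1,4)] by blast
    then show ?case using H.step_props[OF q''(1)] q' by (intro bexI[of _ q'']) auto
  qed
  then show thesis using that by blast
qed

section \<open>The endpoint of the lift as a map from the universal cover\<close>

definition lift_end :: "'b \<Rightarrow> 'a vwalk set \<Rightarrow> 'b" where
  "lift_end a \<alpha> = (THE b. \<exists>q\<in>walks H. hd q = a \<and> last q = b \<and> map f q \<in> \<alpha>)"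

text \<open>This is the well-definedness of the description in \<open>lift_end\<close>, which ranges
  over lifts of all representatives and so chooses none. Any competing lift \<open>r\<close> covers
  a walk equivalent to \<open>map f q\<close>; carrying \<open>q\<close> along the equivalence gives
  a lift of that same walk with the ends of \<open>q\<close>.\<close>

lemma lift_end_class:
  assumes q: "q \<in> walks H"
  shows "lift_end (hd q) (walk_class G (map f q)) = last q"
  unfolding lift_end_def
proof (rule the_equality)
  show "\<exists>r\<in>walks H. hd r = hd q \<and> last r = last q \<and> map f r \<in> walk_class G (map f q)"
    using q G.walk_class_self graph_morphism_walks[OF morphism] by blast
next
  fix b assume "\<exists>r\<in>walks H. hd r = hd q \<and> last r = b \<and> map f r \<in> walk_class G (map f q)"
  then obtain r where r: "r \<in> walks H" "hd r = hd q" "last r = b"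
    "(map f q, map f r) \<in> walk_equiv G" by (auto simp: walk_class_def)
  obtain q' where q': "q' \<in> walks H" "hd q' = hd q" "last q' = last q" "map f q' = map f r"
    using walk_equiv_lift[OF r(4) q] by blast
  \<comment> \<open>\<open>q'\<close> and \<open>r\<close> start together and have the same image,
    so they coincide.\<close>
  then show "b = last q" using walk_lift_unique[of q' r] r by auto
qed

text \<open>Since walks lift, each arrow from \<open>f a\<close> is represented by the image of a
  walk in \<open>H\<close> from \<open>a\<close>. Later arguments can therefore run over walks in
  \<open>H\<close>, where \<open>lift_end_class\<close> evaluates \<open>lift_end\<close>
  directly.\<close>

lemma univ_cover_vertE:
  assumes "\<alpha> \<in> pverts (univ_cover G (f a))" "a \<in> pverts H"
  obtains q where "q \<in> walks H" "hd q = a" "\<alpha> = walk_class G (map f q)"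
proof -
  obtain p where p: "p \<in> walks G" "hd p = f a" "\<alpha> = walk_class G p"
    using assms(1) by (auto simp: G.pverts_univ_cover)
  then show thesis using walk_lift_exists[OF p(1) assms(2) p(2)] that by metis
qed

lemma univ_cover_arcE:
  assumes "(\<alpha>, \<beta>) \<in> parcs (univ_cover G (f a))" "a \<in> pverts H"
  obtains q b where "q \<in> walks H" "hd q = a" "(last q, b) \<in> parcs H"
    "\<alpha> = walk_class G (map f q)" "\<beta> = walk_class G (map f (q @ [b]))"
proof -
  obtain p x where p: "p \<in> walks G" "hd p = f a" "(last p, x) \<in> parcs G"
    "\<alpha> = walk_class G p" "\<beta> = walk_class G (p @ [x])"
    using assms(1) unfolding G.univ_cover_arc_iff by blast
  obtain q where q: "q \<in> walks H" "hd q = a" "map f q = p"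
    using walk_lift_exists[OF p(1) assms(2) p(2)] by blast
  have "f (last q) = last p" using q walks_not_Nil last_map by metis
  then obtain b where "(last q, b) \<in> parcs H" "f b = x"
    using arc_lift_exists[of "last q" x] walks_hd_last[OF q(1)] p by auto
  then show thesis using that[of q b] p q by auto
qed

text \<open>An arc of the cover extends a walk by one edge, and the lift is extended by one arc
  accordingly; the ends of the two lifts are the ends of that arc.\<close>

lemma graph_morphism_lift_end:
  assumes "a \<in> pverts H"
  shows "graph_morphism (univ_cover G (f a)) H (lift_end a)"
  unfolding graph_morphism_def
proof (intro conjI ballI allI impI)
  fix \<alpha> assume "\<alpha> \<in> pverts (univ_cover G (f a))"
  then obtain q where "q \<in> walks H" "hd q = a" "\<alpha> = walk_class G (map f q)"
    using univ_cover_vertE assms by blast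
  then show "lift_end a \<alpha> \<in> pverts H" using lift_end_class walks_hd_last by metis
next
  fix \<alpha> \<beta> assume "(\<alpha>, \<beta>) \<in> parcs (univ_cover G (f a))"
  then obtain q b where q: "q \<in> walks H" "hd q = a" "(last q, b) \<in> parcs H"
    and "\<alpha> = walk_class G (map f q)" "\<beta> = walk_class G (map f (q @ [b]))"
    using univ_cover_arcE assms by blast
  then show "(lift_end a \<alpha>, lift_end a \<beta>) \<in> parcs H"
    using lift_end_class[OF q(1)] lift_end_class[of "q @ [b]"] H.walks_snoc[OF q(1,3)] by auto
qed

lemma f_lift_end:
  assumes "\<alpha> \<in> pverts (univ_cover G (f a))" "a \<in> pverts H"
  shows "f (lift_end a \<alpha>) = univ_proj \<alpha>"
proof -
  obtain q where q: "q \<in> walks H" "hd q = a" "\<alpha> = walk_class G (map f q)"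
    using univ_cover_vertE assms by blast
  then show ?thesis
    using lift_end_class[OF q(1)] G.arrow_target_class graph_morphism_walks[OF morphism q(1)]
      walks_not_Nil[OF q(1)] by (auto simp: last_map)
qed

lemma lift_end_base: "a \<in> pverts H \<Longrightarrow> lift_end a (walk_class G [f a]) = a"
  using lift_end_class[of "[a]"] by simp

text \<open>Induction along a walk \<open>q\<close> in \<open>H\<close> from \<open>a\<close>: its
  initial segments yield a path of classes in the cover, starting at the base point. A competing
  \<sigma> must send the next class to a neighbour of \<open>last q\<close> over \<open>f b\<close>,
  and only \<open>b\<close> qualifies.\<close>

lemma lift_end_unique:
  assumes a: "a \<in> pverts H"
    and \<sigma>: "graph_morphism (univ_cover G (f a)) H \<sigma>" "\<sigma> (walk_class G [f a]) = a"
      "\<And>\<alpha>. \<alpha> \<in> pverts (univ_cover G (f a)) \<Longrightarrow> univ_proj \<alpha> = f (\<sigma> \<alpha>)"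
    and \<alpha>: "\<alpha> \<in> pverts (univ_cover G (f a))"
  shows "\<sigma> \<alpha> = lift_end a \<alpha>"
proof -
  have \<sigma>_class: "\<sigma> (walk_class G (map f q)) = last q" if "q \<in> walks H" "hd q = a" for q
    using that
  proof (induction q rule: rev_induct)
    case Nil
    then show ?case using walks_not_Nil by blast
  next
    case (snoc b q)
    show ?case
    proof (cases "q = []")
      case True
      then show ?thesis using snoc.prems \<sigma>(2) by simp
    next
      case False
      then have q: "q \<in> walks H" "hd q = a" "(last q, b) \<in> parcs H"
        using H.walks_snoc_iff snoc.prems by auto
      have fq: "map f q \<in> walks G" "hd (map f q) = f a" "last (map f q) = f (last q)"
        using graph_morphism_walks[OF morphism q(1)] False q by (auto simp: hd_map last_map)
      have fqb: "map f (q @ [b]) \<in> walks G" "hd (map f (q @ [b])) = f a"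
        using graph_morphism_walks[OF morphism snoc.prems(1)] snoc.prems(2) False
        by (auto simp: hd_map)
      have "(walk_class G (map f q), walk_class G (map f (q @ [b]))) \<in> parcs (univ_cover G (f a))"
        using G.univ_cover_arc_from_class_iff[OF fq(1,2)] graph_morphismD[OF morphism q(3)] fq(3)
        by auto
      then have "(last q, \<sigma> (walk_class G (map f (q @ [b])))) \<in> parcs H"
        using graph_morphismD[OF \<sigma>(1)] snoc.IH[OF q(1,2)] by metis
      moreover have "walk_class G (map f (q @ [b])) \<in> pverts (univ_cover G (f a))"
        using fqb unfolding G.pverts_univ_cover by blast
      then have "f (\<sigma> (walk_class G (map f (q @ [b])))) = f b"
        using \<sigma>(3) G.arrow_target_class[OF fqb(1)] by force
      ultimately show ?thesis using arc_lift_unique q(3) by auto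
    qed
  qed
  \<comment> \<open>Every vertex of the cover comes from such a walk, and both maps send it to
    \<open>last q\<close>.\<close>
  obtain q where "q \<in> walks H" "hd q = a" "\<alpha> = walk_class G (map f q)"
    using univ_cover_vertE[OF \<alpha> a] by blast
  then show ?thesis using \<sigma>_class lift_end_class by metis
qed

end

section \<open>The universal property of the universal homotopy cover\<close>

theorem theorem3p17:
  fixes G :: "'a pair_pre_digraph" and Gt :: "'b pair_pre_digraph"
    and f :: "'b \<Rightarrow> 'a" and v :: 'a and vt :: 'b
  assumes "htpy_graph G" and "v \<in> pverts G"
    and "htpy_graph Gt" and "homotopy_covering Gt G f"
    and "vt \<in> pverts Gt" and "f vt = v"
  shows "\<exists>\<rho>t.
    (graph_morphism (univ_cover G v) Gt \<rho>t \<and>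
     (\<forall>\<alpha>\<in>pverts (univ_cover G v). univ_proj \<alpha> = (f \<circ> \<rho>t) \<alpha>) \<and>
     \<rho>t (walk_class G [v]) = vt) \<and>
    homotopy_covering (univ_cover G v) Gt \<rho>t \<and>
    (\<forall>\<sigma>. graph_morphism (univ_cover G v) Gt \<sigma> \<and>
         (\<forall>\<alpha>\<in>pverts (univ_cover G v). univ_proj \<alpha> = (f \<circ> \<sigma>) \<alpha>) \<and>
         \<sigma> (walk_class G [v]) = vt \<longrightarrow>
         (\<forall>\<alpha>\<in>pverts (univ_cover G v). \<sigma> \<alpha> = \<rho>t \<alpha>))"
proof -
  interpret G: htpy_graph G by fact
  interpret Gt: htpy_graph Gt by fact
  interpret htpy_cover G Gt f by unfold_locales fact
  note vt = \<open>vt \<in> pverts Gt\<close>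
  \<comment> \<open>The lifting lemmas are stated for the cover based at the image of a vertex of
    the covering graph, so \<open>v\<close> is rewritten into that form.\<close>
  have v: "v = f vt" using \<open>f vt = v\<close> by simp
  show ?thesis
    unfolding v
  proof (intro exI[of _ "lift_end vt"] conjI ballI allI impI; (elim conjE)?)
    show "graph_morphism (univ_cover G (f vt)) Gt (lift_end vt)"
      by (rule graph_morphism_lift_end[OF vt])
    show "lift_end vt (walk_class G [f vt]) = vt"
      by (rule lift_end_base[OF vt])
    show "homotopy_covering (univ_cover G (f vt)) Gt (lift_end vt)"
      using homotopy_covering_cancel_left[OF cov G.homotopy_covering_univ_proj
          graph_morphism_lift_end[OF vt] G.pair_sym_digraph_univ_cover] f_lift_end[OF _ vt] by simp
  next
    fix \<alpha> assume "\<alpha> \<in> pverts (univ_cover G (f vt))"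
    then show "univ_proj \<alpha> = (f \<circ> lift_end vt) \<alpha>" using f_lift_end[OF _ vt] by simp
  next
    fix \<sigma> \<alpha>
    assume "graph_morphism (univ_cover G (f vt)) Gt \<sigma>" "\<sigma> (walk_class G [f vt]) = vt"
      "\<forall>\<alpha>\<in>pverts (univ_cover G (f vt)). univ_proj \<alpha> = (f \<circ> \<sigma>) \<alpha>"
      "\<alpha> \<in> pverts (univ_cover G (f vt))"
    then show "\<sigma> \<alpha> = lift_end vt \<alpha>" by (intro lift_end_unique[OF vt]) auto
  qed
qed

end
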